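(* Let $K$ be a finite abstract simplicial complex with a linearly ordered vertex set $(V,\preceq)$, and let $W$ be the partial matching on the face poset of $K$ produced by the algorithm $\mathcal A$. Then $W$ is maximal in the following sense: if $\alpha$ is a face of $K$ not involved in any pair of $W$, then every face $\gamma\subset\alpha$ with $\dim\gamma=\dim\alpha-1$ and every face $\beta\supset\alpha$ of $K$ with $\dim\beta=\dim\alpha+1$ is involved in a pair of $W$.
   Context: $K$ has dimension $d$; faces are nonempty and $\mathcal F^i$ is the set of $i$-dimensional faces. (In general the vertex set may only carry a partial order that is linear on each face; it is then first extended to a linear order.) A face $\alpha\in\mathcal F^i$ is written $[\alpha_0,\ldots,\alpha_i]$ with $\alpha_0\prec\cdots\prec\alpha_i$, and $\alpha_r$ is said to appear in position $r$ of $\alpha$. Faces are ordered lexicographically. Algorithm $\mathcal A$: start with $W:=\varnothing$ and $F^i:=\mathcal F^i$ for $0\le i\le d$. For $i=d-1,d-2,\ldots,0$ in this order, run process $\mathcal P^i$ provided $F^i$ and $F^{i+1}$ are both nonempty at that moment. Process $\mathcal P^i$ runs $r=i+1,i,\ldots,0$ in descending order; for each $r$ it runs over all $v\in V$ from the $\preceq$-largest to the smallest; for each $(r,v)$ it runs over all $\alpha\in\mathcal F^i$ in increasing lexicographic order. For each $(i,r,v,\alpha)$: if $v\notin\alpha$, $\alpha\cup\{v\}\in\mathcal F^{i+1}$ with $v$ appearing in position $r$ of $\alpha\cup\{v\}$, and at that moment $\alpha\in F^i$ and $\alpha\cup\{v\}\in F^{i+1}$, then add the pair $(\alpha,\alpha\cup\{v\})$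 to $W$ (written $\alpha\nearrow\alpha\cup\{v\}$), and remove $\alpha$ from $F^i$ and $\alpha\cup\{v\}$ from $F^{i+1}$. *)

theory Defs
  imports Main "HOL-Library.List_Lexorder"
begin

text \<open>
  The linear order on the vertex set is the one of the class \<open>linorder\<close>, restricted to
  \<open>V\<close>; \<open>sorted_list_of_set \<alpha>\<close> is then the list written
  \<open>[\<alpha>\<^sub>0, \<dots>, \<alpha>\<^sub>i]\<close> for a face \<open>\<alpha>\<close>.
\<close>

definition finite_simplicial_complex :: "'a set \<Rightarrow> 'a set set \<Rightarrow> bool" where
  "finite_simplicial_complex V K \<longleftrightarrow>
     finite V \<and>
     (\<forall>\<alpha>\<in>K. \<alpha> \<noteq> {} \<and> \<alpha> \<subseteq> V) \<and>
     (\<forall>v\<in>V. {v} \<in> K) \<and>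
     (\<forall>\<alpha>\<in>K. \<forall>\<gamma>. \<gamma> \<noteq> {} \<and> \<gamma> \<subseteq> \<alpha> \<longrightarrow> \<gamma> \<in> K)"

text \<open>The truncated subtraction is harmless: faces are nonempty.\<close>

definition face_dim :: "'a set \<Rightarrow> nat" where
  "face_dim \<alpha> = card \<alpha> - 1"

definition complex_dim :: "'a set set \<Rightarrow> nat" where
  "complex_dim K = Max (face_dim ` K)"

definition faces_of_dim :: "'a set set \<Rightarrow> nat \<Rightarrow> 'a set set" where
  "faces_of_dim K i = {\<alpha> \<in> K. face_dim \<alpha> = i}"

definition appears_in_position :: "'a::linorder \<Rightarrow> nat \<Rightarrow> 'a set \<Rightarrow> bool" where
  "appears_in_position v r \<alpha> \<longleftrightarrow> r < card \<alpha> \<and> sorted_list_of_set \<alpha> ! r = v"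

text \<open>
  The inner \<open>sorted_list_of_set\<close> turns a face into its increasing list of vertices; the
  outer one sorts these lists by the lexicographic order on lists.
\<close>

definition lex_faces :: "'a::linorder set set \<Rightarrow> nat \<Rightarrow> 'a set list" where
  "lex_faces K i = map set (sorted_list_of_set (sorted_list_of_set ` faces_of_dim K i))"

text \<open>
  The state of the algorithm: \<open>matched\<close> is \<open>W\<close>, a pair \<open>(\<alpha>, \<beta>)\<close> in it standing for
  \<open>\<alpha> \<nearrow> \<beta>\<close>, and \<open>remaining i\<close> is \<open>F\<^sup>i\<close>.
\<close>

record 'a matching_state =
  matched :: "('a set \<times> 'a set) set"
  remaining :: "nat \<Rightarrow> 'a set set"

definition match_step ::
  "'a::linorder set set \<Rightarrow> nat \<Rightarrow> nat \<Rightarrow> 'a \<Rightarrow> 'a set \<Rightarrow> 'a matching_state \<Rightarrow> 'a matching_state"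
where
  "match_step K i r v \<alpha> s =
     (let \<beta> = \<alpha> \<union> {v} in
      if v \<notin> \<alpha> \<and> \<beta> \<in> faces_of_dim K (i + 1) \<and> appears_in_position v r \<beta> \<and>
         \<alpha> \<in> remaining s i \<and> \<beta> \<in> remaining s (i + 1)
      then \<lparr> matched = matched s \<union> {(\<alpha>, \<beta>)},
             remaining = (remaining s)
               (i := remaining s i - {\<alpha>},
                i + 1 := remaining s (i + 1) - {\<beta>}) \<rparr>
      else s)"

text \<open>\<open>fold\<close> runs through its list from left to right; \<open>rev [0..<n]\<close> is \<open>[n - 1, \<dots>, 0]\<close>.\<close>

definition run_process ::
  "'a::linorder set \<Rightarrow> 'a set set \<Rightarrow> nat \<Rightarrow> 'a matching_state \<Rightarrow> 'a matching_state"
where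
  "run_process V K i =
     fold (\<lambda>r.
       fold (\<lambda>v.
         fold (\<lambda>\<alpha>. match_step K i r v \<alpha>) (lex_faces K i))
       (rev (sorted_list_of_set V)))
     (rev [0..<i + 2])"

definition initial_state :: "'a set set \<Rightarrow> 'a matching_state" where
  "initial_state K = \<lparr> matched = {}, remaining = faces_of_dim K \<rparr>"

definition run_algorithm :: "'a::linorder set \<Rightarrow> 'a set set \<Rightarrow> 'a matching_state" where
  "run_algorithm V K =
     fold (\<lambda>i s.
       if remaining s i \<noteq> {} \<and> remaining s (i + 1) \<noteq> {} then run_process V K i s else s)
     (rev [0..<complex_dim K])
     (initial_state K)"

definition algorithm_matching :: "'a::linorder set \<Rightarrow> 'a set set \<Rightarrow> ('a set \<times> 'a set) set" where
  "algorithm_matching V K = matched (run_algorithm V K)"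

definition involved_in :: "'a set \<Rightarrow> ('a set \<times> 'a set) set \<Rightarrow> bool" where
  "involved_in \<alpha> W \<longleftrightarrow> (\<exists>(\<gamma>, \<beta>) \<in> W. \<alpha> = \<gamma> \<or> \<alpha> = \<beta>)"

end

theory Submission
  imports Defs
begin

text \<open>
  The algorithm is greedy and never returns a face to the sets \<open>F\<^sup>i\<close>, which explains maximality.
  Let \<open>\<gamma> \<subset> \<beta> = \<gamma> \<union> {v}\<close> be faces of dimensions \<open>i\<close> and \<open>i + 1\<close>, and let \<open>r\<close> be the position
  of \<open>v\<close> in \<open>\<beta>\<close>. The loops of the process \<open>\<P>\<^sup>i\<close> visit the quadruple \<open>(i, r, v, \<gamma>)\<close>. If both
  faces are still available at that moment, the pair \<open>(\<gamma>, \<beta>)\<close> is matched; so after this visit one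
  of the two is no longer available, and this persists to the end (\<open>run_algorithm_blocks\<close>). If
  \<open>\<P>\<^sup>i\<close> is skipped, then \<open>F\<^sup>i\<close> or \<open>F\<^sup>i\<^sup>+\<^sup>1\<close> is empty, and again one of the two faces is unavailable.

  On the other hand a face leaves \<open>F\<^sup>i\<close> only by entering a pair, so at the end the faces of \<open>K\<close>
  that are in no pair are still available (\<open>run_algorithm_accounts\<close>). Hence of two incident faces
  of consecutive dimensions at least one is in a pair (\<open>incident_faces_involved\<close>).
\<close>

lemma fold_preserves:
  assumes "\<And>y s. Q s \<Longrightarrow> Q (f y s)" and "Q s"
  shows "Q (fold f xs s)"
  using assms(2) by (rule fold_invariant[where Q = "\<lambda>_. True", rotated]) (simp_all add: assms(1))

text \<open>
  The form in which the completeness of a loop is used: one visit that forces \<open>Q\<close> from an arbitrary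
  state is enough, whatever the earlier visits did, when no later visit can destroy \<open>Q\<close>.
\<close>

lemma fold_establishes:
  assumes "x \<in> set xs"
    and establish: "\<And>s. Q (f x s)"
    and preserve: "\<And>y s. Q s \<Longrightarrow> Q (f y s)"
  shows "Q (fold f xs s)"
proof -
  obtain ys zs where xs: "xs = ys @ x # zs"
    using \<open>x \<in> set xs\<close> by (meson split_list)
  have "Q (fold f zs (f x (fold f ys s)))"
    by (intro fold_preserves[where Q = Q] preserve establish)
  then show ?thesis by (simp add: xs)
qed

lemma run_process_preserves:
  assumes "\<And>r v \<alpha> s. P s \<Longrightarrow> P (match_step K i r v \<alpha> s)" and "P s"
  shows "P (run_process V K i s)"
  unfolding run_process_def
  by (intro fold_preserves[where Q = P] assms)

lemma run_algorithm_preserves: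
  assumes "\<And>i r v \<alpha> s. P s \<Longrightarrow> P (match_step K i r v \<alpha> s)" and "P (initial_state K)"
  shows "P (run_algorithm V K)"
  unfolding run_algorithm_def
proof (rule fold_preserves[where Q = P])
  fix i s
  assume "P s"
  then have "P (run_process V K i s)"
    by (intro run_process_preserves[where P = P] assms(1))
  with \<open>P s\<close> show
    "P (if remaining s i \<noteq> {} \<and> remaining s (i + 1) \<noteq> {} then run_process V K i s else s)"
    by simp
qed (rule assms(2))

text \<open>
  This is the negation of the availability test of a step for \<open>(\<gamma>, \<beta>)\<close>. It is used instead of
  the pair being matched because a visit guarantees no more: either face may have been used in
  another pair before.
\<close>

definition blocked :: "nat \<Rightarrow> 'a set \<Rightarrow> 'a set \<Rightarrow> 'a matching_state \<Rightarrow> bool" where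
  "blocked i \<gamma> \<beta> s \<longleftrightarrow> \<gamma> \<notin> remaining s i \<or> \<beta> \<notin> remaining s (i + 1)"

lemma match_step_blocked:
  "blocked i \<gamma> \<beta> s \<Longrightarrow> blocked i \<gamma> \<beta> (match_step K j r v \<alpha> s)"
  by (auto simp: blocked_def match_step_def Let_def)

lemma match_step_blocks:
  assumes "v \<notin> \<gamma>" "\<gamma> \<union> {v} \<in> faces_of_dim K (i + 1)" "appears_in_position v r (\<gamma> \<union> {v})"
  shows "blocked i \<gamma> (\<gamma> \<union> {v}) (match_step K i r v \<gamma> s)"
  using assms by (auto simp: blocked_def match_step_def Let_def)

lemma set_lex_faces:
  assumes "finite V" "\<forall>\<alpha>\<in>K. \<alpha> \<subseteq> V"
  shows "set (lex_faces K i) = faces_of_dim K i"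
proof -
  have "faces_of_dim K i \<subseteq> Pow V"
    using assms by (auto simp: faces_of_dim_def)
  then have "finite (faces_of_dim K i)" "\<forall>\<alpha>\<in>faces_of_dim K i. finite \<alpha>"
    using \<open>finite V\<close> by (auto intro: finite_subset)
  then show ?thesis
    by (auto simp: lex_faces_def image_image)
qed

text \<open>
  Each of the three nested loops ranges over all possible values of its variable, so the visit
  \<open>(i, r, v, \<gamma>)\<close> for the actual position \<open>r\<close> of \<open>v\<close> does occur; the three applications of
  \<open>fold_establishes\<close> follow it from the outer loop to the inner one.
\<close>

lemma run_process_blocks:
  assumes "finite V" "\<forall>\<alpha>\<in>K. \<alpha> \<subseteq> V"
    and \<gamma>: "\<gamma> \<in> faces_of_dim K i" and v: "v \<notin> \<gamma>"
    and \<beta>: "\<gamma> \<union> {v} \<in> faces_of_dim K (i + 1)"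
  shows "blocked i \<gamma> (\<gamma> \<union> {v}) (run_process V K i s)"
proof -
  let ?B = "blocked i \<gamma> (\<gamma> \<union> {v})"
  have "\<gamma> \<union> {v} \<subseteq> V"
    using assms by (auto simp: faces_of_dim_def)
  then have "v \<in> V" and fin: "finite (\<gamma> \<union> {v})"
    using \<open>finite V\<close> by (auto intro: finite_subset)
  have "v \<in> set (sorted_list_of_set (\<gamma> \<union> {v}))"
    by (simp only: set_sorted_list_of_set[OF fin]) simp
  then obtain r where r: "appears_in_position v r (\<gamma> \<union> {v})"
    unfolding appears_in_position_def in_set_conv_nth
    by (auto simp del: sorted_list_of_set_insert_remove)
  then have "r < i + 2"
    using \<beta> by (auto simp: appears_in_position_def faces_of_dim_def face_dim_def)
  show ?thesis
    unfolding run_process_def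
  proof (rule fold_establishes[where x = r])
    show "r \<in> set (rev [0..<i + 2])"
      using \<open>r < i + 2\<close> by (simp, linarith)
  next
    fix s
    show "?B (fold (\<lambda>v. fold (match_step K i r v) (lex_faces K i)) (rev (sorted_list_of_set V)) s)"
    proof (rule fold_establishes[where x = v])
      show "v \<in> set (rev (sorted_list_of_set V))"
        using \<open>v \<in> V\<close> \<open>finite V\<close> by simp
    next
      fix s
      show "?B (fold (match_step K i r v) (lex_faces K i) s)"
      proof (rule fold_establishes[where x = \<gamma>])
        show "\<gamma> \<in> set (lex_faces K i)"
          using \<gamma> by (simp add: set_lex_faces[OF assms(1,2)])
      qed (rule match_step_blocks[OF v \<beta> r] match_step_blocked, assumption?)+
    qed (intro fold_preserves[where Q = ?B] match_step_blocked)
  qed (intro fold_preserves[where Q = ?B] match_step_blocked)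
qed

lemma run_algorithm_blocks:
  assumes "finite V" "\<forall>\<alpha>\<in>K. \<alpha> \<subseteq> V"
    and \<gamma>: "\<gamma> \<in> faces_of_dim K i" and v: "v \<notin> \<gamma>"
    and \<beta>: "\<gamma> \<union> {v} \<in> faces_of_dim K (i + 1)"
  shows "blocked i \<gamma> (\<gamma> \<union> {v}) (run_algorithm V K)"
  unfolding run_algorithm_def
proof (rule fold_establishes[where x = i])
  have "K \<subseteq> Pow V"
    using assms by auto
  then have "finite K"
    using \<open>finite V\<close> by (auto intro: finite_subset)
  \<comment> \<open>The upper face witnesses that the outer loop, which starts at \<open>d - 1\<close>, reaches \<open>i\<close>.\<close>
  then have "i + 1 \<le> complex_dim K"
    using \<beta> unfolding complex_dim_def faces_of_dim_def
    by (metis (mono_tags, lifting) Max_ge finite_imageI image_eqI mem_Collect_eq)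
  then show "i \<in> set (rev [0..<complex_dim K])"
    by simp
next
  fix s
  show "blocked i \<gamma> (\<gamma> \<union> {v})
    (if remaining s i \<noteq> {} \<and> remaining s (i + 1) \<noteq> {} then run_process V K i s else s)"
  proof (cases "remaining s i \<noteq> {} \<and> remaining s (i + 1) \<noteq> {}")
    case True
    with run_process_blocks[OF assms] show ?thesis by simp
  next
    case False
    then show ?thesis by (auto simp: blocked_def)
  qed
next
  fix j s
  let ?B = "blocked i \<gamma> (\<gamma> \<union> {v})"
  assume "?B s"
  then have "?B (run_process V K j s)"
    by (intro run_process_preserves[where P = ?B] match_step_blocked)
  with \<open>?B s\<close> show
    "?B (if remaining s j \<noteq> {} \<and> remaining s (j + 1) \<noteq> {} then run_process V K j s else s)"
    by simp
qed

text \<open>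
  By this invariant a face that is in no pair at the end is still available, so two incident faces
  in no pair would contradict \<open>blocked\<close>.
\<close>

definition accounts_for :: "'a set set \<Rightarrow> 'a matching_state \<Rightarrow> bool" where
  "accounts_for K s \<longleftrightarrow>
     (\<forall>\<phi>\<in>K. \<phi> \<in> remaining s (face_dim \<phi>) \<or> involved_in \<phi> (matched s))"

lemma match_step_accounts:
  "accounts_for K s \<Longrightarrow> accounts_for K (match_step L i r v \<alpha> s)"
  by (auto simp: accounts_for_def match_step_def Let_def involved_in_def)

lemma run_algorithm_accounts: "accounts_for K (run_algorithm V K)"
  by (rule run_algorithm_preserves[where P = "accounts_for K"], rule match_step_accounts)
    (simp_all add: accounts_for_def initial_state_def faces_of_dim_def)

lemma incident_faces_involved:
  assumes complex: "finite_simplicial_complex V K"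
    and K: "\<gamma> \<in> K" "\<beta> \<in> K" and sub: "\<gamma> \<subset> \<beta>" and dim: "face_dim \<beta> = face_dim \<gamma> + 1"
  shows "involved_in \<gamma> (algorithm_matching V K) \<or> involved_in \<beta> (algorithm_matching V K)"
proof -
  have V: "finite V" "\<forall>\<alpha>\<in>K. \<alpha> \<subseteq> V" and ne: "\<gamma> \<noteq> {}"
    using complex K unfolding finite_simplicial_complex_def by blast+
  have fin: "finite \<beta>" "finite \<gamma>"
    using V K by (meson finite_subset)+
  \<comment> \<open>Nonemptiness makes \<open>face_dim \<gamma>\<close> the true difference \<open>card \<gamma> - 1\<close>.\<close>
  have "card \<gamma> > 0"
    using ne fin by (simp add: card_gt_0_iff)
  then have "card (\<beta> - \<gamma>) = 1"
    using dim sub fin by (simp add: face_dim_def card_Diff_subset psubset_imp_subset)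
  then obtain v where "\<beta> - \<gamma> = {v}"
    using card_1_singletonE by blast
  then have v: "\<beta> = \<gamma> \<union> {v}" "v \<notin> \<gamma>"
    using sub by auto
  have "blocked (face_dim \<gamma>) \<gamma> \<beta> (run_algorithm V K)"
    unfolding v(1)
    by (rule run_algorithm_blocks) (use V K dim v in \<open>auto simp: faces_of_dim_def\<close>)
  with run_algorithm_accounts[of K V] K dim show ?thesis
    by (auto simp: blocked_def accounts_for_def algorithm_matching_def)
qed

theorem mainTheorem3:
  fixes V :: "'a::linorder set" and K :: "'a set set" and W :: "('a set \<times> 'a set) set"
    and \<alpha> :: "'a set"
  assumes complex: "finite_simplicial_complex V K"
    and W: "W = algorithm_matching V K"
    and face: "\<alpha> \<in> K"
    and unmatched: "\<not> involved_in \<alpha> W"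
  shows "(\<forall>\<gamma>\<in>K. \<gamma> \<subset> \<alpha> \<and> int (face_dim \<gamma>) = int (face_dim \<alpha>) - 1 \<longrightarrow> involved_in \<gamma> W) \<and>
         (\<forall>\<beta>\<in>K. \<alpha> \<subset> \<beta> \<and> face_dim \<beta> = face_dim \<alpha> + 1 \<longrightarrow> involved_in \<beta> W)"
proof (intro conjI ballI impI)
  fix \<gamma>
  assume "\<gamma> \<in> K" "\<gamma> \<subset> \<alpha> \<and> int (face_dim \<gamma>) = int (face_dim \<alpha>) - 1"
  with incident_faces_involved[OF complex, of \<gamma> \<alpha>] face unmatched W
  show "involved_in \<gamma> W" by auto
next
  fix \<beta>
  assume "\<beta> \<in> K" "\<alpha> \<subset> \<beta> \<and> face_dim \<beta> = face_dim \<alpha> + 1"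
  with incident_faces_involved[OF complex, of \<alpha> \<beta>] face unmatched W
  show "involved_in \<beta> W" by auto
qed

end
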